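(* Each of the five six-vertex digraphs $$\overleftrightarrow{K}_3\mathbin{\dot\cup}\overrightarrow{P}_3,\quad \overleftrightarrow{K}_3\mathbin{\dot\cup}\overrightarrow{V}_3,\quad \overleftrightarrow{K}_3\mathbin{\dot\cup}\overrightarrow{\Lambda}_3,\quad \overleftrightarrow{K}_2\mathbin{\dot\cup}T_4^+,\quad \overleftrightarrow{K}_2\mathbin{\dot\cup}T_4^-$$ packs with an isomorphic copy of itself; that is, for each such digraph $D$ there is a permutation $\pi$ of $V(D)$ with $A(D)\cap\pi(A(D))=\varnothing$.
   Context: All digraphs are finite and loopless; opposite arcs $(u,v)$ and $(v,u)$ may both be present, but repeated arcs are not allowed. $A(D)$ denotes the arc set of $D$. Two digraphs $D_1,D_2$ of the same order pack if there is a bijection $\pi:V(D_1)\to V(D_2)$ such that $A(D_2)$ and $\pi(A(D_1))=\{(\pi(u),\pi(v)):(u,v)\in A(D_1)\}$ are disjoint. Notation: $\dot\cup$ denotes disjoint union of digraphs, with no arcs between the two parts. $\overleftrightarrow{K}_m$ is the digraph on $m$ vertices with all $m(m-1)$ ordered pairs of distinct vertices as arcs. On three vertices $x,y,z$: $\overrightarrow{P}_3$ has arc set $\{(x,y),(y,z)\}$; $\overrightarrow{V}_3$ has arc set $\{(y,x),(y,z)\}$ (central source); $\overrightarrow{\Lambda}_3$ has arc set $\{(x,y),(z,y)\}$ (central sink). $T_4^+$ is the four-vertex digraph obtained from a directed triangle $a\to b\to c\to a$ by adding a vertex $w$ with arcs $(w,a),(w,b),(w,c)$; $T_4^-$ is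 the converse of $T_4^+$ (all arcs reversed). *)

theory Defs
  imports "Graph_Theory.Graph_Theory" "HOL-Combinatorics.Permutations"
begin

text \<open>
  A finite loopless digraph without repeated arcs is a \<^typ>\<open>'a pair_pre_digraph\<close> satisfying
  \<^const>\<open>pair_digraph\<close>; opposite arcs are allowed.
\<close>

definition map_arcs :: "('a \<Rightarrow> 'b) \<Rightarrow> ('a \<times> 'a) set \<Rightarrow> ('b \<times> 'b) set" where
  "map_arcs \<pi> A = {(\<pi> u, \<pi> v) | u v. (u, v) \<in> A}"

text \<open>For finite digraphs, the existence of the bijection forces the orders to be equal.\<close>

definition packs :: "'a pair_pre_digraph \<Rightarrow> 'b pair_pre_digraph \<Rightarrow> bool" where
  "packs D1 D2 \<longleftrightarrow>
     (\<exists>\<pi>. bij_betw \<pi> (pverts D1) (pverts D2) \<and> parcs D2 \<inter> map_arcs \<pi> (parcs D1) = {})"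

definition disj_union :: "'a pair_pre_digraph \<Rightarrow> 'b pair_pre_digraph \<Rightarrow> ('a + 'b) pair_pre_digraph"
    (infixr "\<uplus>\<^sub>D" 65) where
  "G \<uplus>\<^sub>D H = \<lparr> pverts = pverts G <+> pverts H,
               parcs = map_arcs Inl (parcs G) \<union> map_arcs Inr (parcs H) \<rparr>"

definition rev_digraph :: "'a pair_pre_digraph \<Rightarrow> 'a pair_pre_digraph" where
  "rev_digraph G = \<lparr> pverts = pverts G, parcs = (parcs G)\<inverse> \<rparr>"

definition complete_bi :: "nat \<Rightarrow> nat pair_pre_digraph" where
  "complete_bi m = \<lparr> pverts = {0..<m}, parcs = {(u, v). u < m \<and> v < m \<and> u \<noteq> v} \<rparr>"

text \<open>The vertices \<open>x, y, z\<close> are \<open>0, 1, 2\<close>.\<close>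

definition P3 :: "nat pair_pre_digraph" where
  "P3 = \<lparr> pverts = {0, 1, 2}, parcs = {(0, 1), (1, 2)} \<rparr>"

definition V3 :: "nat pair_pre_digraph" where
  "V3 = \<lparr> pverts = {0, 1, 2}, parcs = {(1, 0), (1, 2)} \<rparr>"

definition Lambda3 :: "nat pair_pre_digraph" where
  "Lambda3 = \<lparr> pverts = {0, 1, 2}, parcs = {(0, 1), (2, 1)} \<rparr>"

text \<open>The vertices \<open>a, b, c, w\<close> are \<open>0, 1, 2, 3\<close>.\<close>

definition T4_plus :: "nat pair_pre_digraph" where
  "T4_plus = \<lparr> pverts = {0, 1, 2, 3},
               parcs = {(0, 1), (1, 2), (2, 0)} \<union> {(3, 0), (3, 1), (3, 2)} \<rparr>"

definition T4_minus :: "nat pair_pre_digraph" where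
  "T4_minus = rev_digraph T4_plus"

lemma complete_bi_complete_digraph: "complete_digraph m (with_proj (complete_bi m))"
  by (auto simp: complete_digraph_pair_def complete_bi_def)

lemma pair_digraph_disj_union:
  assumes "pair_digraph G" "pair_digraph H"
  shows "pair_digraph (G \<uplus>\<^sub>D H)"
proof -
  interpret G: pair_digraph G by fact
  interpret H: pair_digraph H by fact
  have *: "map_arcs f A = map_prod f f ` A" for f :: "'c \<Rightarrow> 'd" and A
    by (auto simp: map_arcs_def)
  show ?thesis
    using G.pair_finite_verts H.pair_finite_verts G.pair_finite_arcs H.pair_finite_arcs
    by unfold_locales
       (auto simp: disj_union_def * dest: G.wellformed' H.wellformed' G.pair_no_loops H.pair_no_loops)
qed

lemma pair_digraph_small:
  "pair_digraph P3" "pair_digraph V3" "pair_digraph Lambda3"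
  "pair_digraph T4_plus" "pair_digraph T4_minus"
  by (unfold_locales; auto simp: P3_def V3_def Lambda3_def T4_plus_def T4_minus_def rev_digraph_def)+

lemma pair_digraph_complete_bi: "pair_digraph (complete_bi m)"
  using pair_graphI_complete[OF complete_bi_complete_digraph] by (simp add: pair_graph_def)

lemma six_vertex_digraphs:
  assumes "D \<in> {complete_bi 3 \<uplus>\<^sub>D P3, complete_bi 3 \<uplus>\<^sub>D V3, complete_bi 3 \<uplus>\<^sub>D Lambda3,
                complete_bi 2 \<uplus>\<^sub>D T4_plus, complete_bi 2 \<uplus>\<^sub>D T4_minus}"
  shows "pair_digraph D" "card (pverts D) = 6"
  using assms
  by (auto simp: pair_digraph_small pair_digraph_complete_bi pair_digraph_disj_union)
     (auto simp: disj_union_def complete_bi_def P3_def V3_def Lambda3_def T4_plus_def T4_minus_def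
       rev_digraph_def card_Plus)

end

theory Submission
  imports Defs
begin

text \<open>
  A copy of \<open>K\<^sub>m\<close> must be sent to an independent set. Beside \<open>K\<^sub>3\<close>, the two ends of the path together
  with a vertex of \<open>K\<^sub>3\<close> form one; the path then fits on the remaining three vertices with its two
  ends placed on the other two vertices of \<open>K\<^sub>3\<close>. Beside \<open>K\<^sub>2\<close>, a vertex of \<open>K\<^sub>2\<close> and the
  apex \<open>w\<close> form an independent pair; the other vertex of \<open>K\<^sub>2\<close> becomes the new apex, and the
  triangle is reversed. In both cases the permutation is a product of two disjoint transpositions,
  and it is carried to any isomorphic digraph by conjugation.
\<close>

lemma map_arcs_disjoint_iff:
  "A \<inter> map_arcs \<pi> B = {} \<longleftrightarrow> (\<forall>(u, v) \<in> B. (\<pi> u, \<pi> v) \<notin> A)"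
  unfolding map_arcs_def by blast

lemma complete_bi_numeral_arcs:
  "parcs (complete_bi 2) = {(0, 1), (1, 0)}"
  "parcs (complete_bi 3) = {(0, 1), (1, 0), (0, 2), (2, 0), (1, 2), (2, 1)}"
  by (auto simp: complete_bi_def)

lemma map_arcs_insert: "map_arcs f (insert (u, v) A) = insert (f u, f v) (map_arcs f A)"
  and map_arcs_empty: "map_arcs f {} = {}"
  by (auto simp: map_arcs_def)

text \<open>All three digraphs on three vertices lie inside the bidirected path 0 - 1 - 2.
  Disjointness passes to subsets of arcs, so one permutation that packs the enlarged digraph
  \<open>?A\<close> with itself serves them all.\<close>

lemma self_packing_K3_path:
  fixes H :: "nat pair_pre_digraph"
  assumes "parcs H \<subseteq> {(0, 1), (1, 0), (1, 2), (2, 1)}" and "{0, 2} \<subseteq> pverts H"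
  shows "\<exists>\<pi>. \<pi> permutes pverts (complete_bi 3 \<uplus>\<^sub>D H) \<and>
    parcs (complete_bi 3 \<uplus>\<^sub>D H) \<inter> map_arcs \<pi> (parcs (complete_bi 3 \<uplus>\<^sub>D H)) = {}"
proof (intro exI conjI)
  \<comment> \<open>The triangle goes to \<open>Inl 0\<close>, \<open>Inr 0\<close>,
    \<open>Inr 2\<close>, and the path to \<open>Inl 1\<close>, \<open>Inr 1\<close>,
    \<open>Inl 2\<close> in this order.\<close>
  let ?\<pi> = "transpose (Inl 1) (Inr 0) \<circ> transpose (Inl 2) (Inr 2) :: nat + nat \<Rightarrow> nat + nat"
  let ?A = "map_arcs Inl (parcs (complete_bi 3)) \<union>
    map_arcs Inr {(0, 1), (1, 0), (1, 2), (2, 1)} :: ((nat + nat) \<times> (nat + nat)) set"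
  show "?\<pi> permutes pverts (complete_bi 3 \<uplus>\<^sub>D H)"
    using assms(2)
    by (intro permutes_compose permutes_swap_id) (auto simp: disj_union_def complete_bi_def)
  have "parcs (complete_bi 3 \<uplus>\<^sub>D H) \<subseteq> ?A"
    using assms(1) by (auto simp: disj_union_def map_arcs_def)
  moreover have "?A \<inter> map_arcs ?\<pi> ?A = {}"
    by (simp add: map_arcs_disjoint_iff complete_bi_numeral_arcs map_arcs_insert map_arcs_empty
        transpose_def)
  ultimately show "parcs (complete_bi 3 \<uplus>\<^sub>D H) \<inter> map_arcs ?\<pi> (parcs (complete_bi 3 \<uplus>\<^sub>D H)) = {}"
    unfolding map_arcs_disjoint_iff by blast
qed

lemma self_packing_K2_T4:
  assumes "T \<in> {T4_plus, T4_minus}"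
  shows "\<exists>\<pi>. \<pi> permutes pverts (complete_bi 2 \<uplus>\<^sub>D T) \<and>
    parcs (complete_bi 2 \<uplus>\<^sub>D T) \<inter> map_arcs \<pi> (parcs (complete_bi 2 \<uplus>\<^sub>D T)) = {}"
proof (intro exI conjI)
  \<comment> \<open>The first swap exchanges a vertex of the 2-clique with the apex, the second
    reverses the triangle. Reversing all arcs preserves disjointness, so the same choice suits
    \<open>T4_minus\<close>.\<close>
  let ?\<pi> = "transpose (Inl 1) (Inr 3) \<circ> transpose (Inr 0) (Inr 1) :: nat + nat \<Rightarrow> nat + nat"
  have arcs: "parcs T4_plus = {(0, 1), (1, 2), (2, 0), (3, 0), (3, 1), (3, 2)}"
    "parcs T4_minus = {(1, 0), (2, 1), (0, 2), (0, 3), (1, 3), (2, 3)}"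
    by (auto simp: T4_plus_def T4_minus_def rev_digraph_def)
  show "?\<pi> permutes pverts (complete_bi 2 \<uplus>\<^sub>D T)"
    using assms by (intro permutes_compose permutes_swap_id)
      (auto simp: disj_union_def complete_bi_def T4_minus_def rev_digraph_def T4_plus_def)
  show "parcs (complete_bi 2 \<uplus>\<^sub>D T) \<inter> map_arcs ?\<pi> (parcs (complete_bi 2 \<uplus>\<^sub>D T)) = {}"
    using assms by (elim insertE emptyE)
      (simp_all add: map_arcs_disjoint_iff disj_union_def complete_bi_numeral_arcs arcs
        map_arcs_insert map_arcs_empty transpose_def)
qed

lemma self_packing_transport:
  assumes "digraph_iso (with_proj G) (with_proj H)"
    and \<pi>: "\<pi> permutes pverts G" "parcs G \<inter> map_arcs \<pi> (parcs G) = {}"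
  shows "\<exists>\<sigma>. \<sigma> permutes pverts H \<and> parcs H \<inter> map_arcs \<sigma> (parcs H) = {}"
proof -
  obtain h where h: "pre_digraph.digraph_isomorphism (with_proj G) h"
    and H: "with_proj H = app_iso h (with_proj G)"
    using assms(1) by (auto simp: digraph_iso_def)
  let ?f = "iso_verts h"
  have wf: "wf_digraph (with_proj G)" and inj: "inj_on ?f (pverts G)"
    using h by (auto simp: pre_digraph.digraph_isomorphism_def)
  interpret wf_digraph "with_proj G" by (fact wf)
  have verts: "pverts H = ?f ` pverts G"
    using arg_cong[OF H, of verts] by simp
  \<comment> \<open>An isomorphism also carries a map on arcs. Comparing end pairs eliminates it,
    since an arc of a pair digraph is its own pair of ends.\<close>
  have arcs: "parcs H = (\<lambda>(u, v). (?f u, ?f v)) ` parcs G"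
    using arcs_ends_app_iso_eq[OF h] by (simp flip: H)
  have in_verts: "u \<in> pverts G" "v \<in> pverts G" if "(u, v) \<in> parcs G" for u v
    using that tail_in_verts[of "(u, v)"] head_in_verts[of "(u, v)"] by auto
  \<comment> \<open>This is the conjugate of \<pi> by \<open>?f\<close> on the image of
    \<open>pverts G\<close>, and the identity elsewhere.\<close>
  let ?\<sigma> = "map_permutation (pverts G) ?f \<pi>"
  have \<sigma>: "?\<sigma> (?f u) = ?f (\<pi> u)" if "u \<in> pverts G" for u
    using that inj by (simp add: map_permutation_apply)
  have "(?\<sigma> (?f u), ?\<sigma> (?f v)) \<notin> parcs H" if uv: "(u, v) \<in> parcs G" for u v
  proof
    assume "(?\<sigma> (?f u), ?\<sigma> (?f v)) \<in> parcs H"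
    then obtain x y where xy: "(x, y) \<in> parcs G" "?f x = ?f (\<pi> u)" "?f y = ?f (\<pi> v)"
      using \<sigma> in_verts[OF uv] by (auto simp: arcs)
    then have "x = \<pi> u" "y = \<pi> v"
      using inj in_verts[OF uv] in_verts[OF xy(1)] permutes_in_image[OF \<pi>(1)]
      by (auto dest: inj_onD)
    with \<pi>(2) uv xy(1) show False by (auto simp: map_arcs_disjoint_iff)
  qed
  then have "parcs H \<inter> map_arcs ?\<sigma> (parcs H) = {}"
    unfolding map_arcs_disjoint_iff by (subst (1) arcs) auto
  moreover have "?\<sigma> permutes pverts H"
    unfolding verts using \<pi>(1) inj by (intro map_permutation_permutes inj_on_imp_bij_betw)
  ultimately show ?thesis by blast
qed

theorem theorem1p3:
  fixes D :: "'a pair_pre_digraph"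
  assumes "D\<^sub>0 \<in> {complete_bi 3 \<uplus>\<^sub>D P3, complete_bi 3 \<uplus>\<^sub>D V3, complete_bi 3 \<uplus>\<^sub>D Lambda3,
                 complete_bi 2 \<uplus>\<^sub>D T4_plus, complete_bi 2 \<uplus>\<^sub>D T4_minus}"
    and "digraph_iso (with_proj D\<^sub>0) (with_proj D)"
  shows "(\<exists>D' :: 'a pair_pre_digraph. digraph_iso (with_proj D) (with_proj D') \<and> packs D D') \<and>
         (\<exists>\<pi>. \<pi> permutes pverts D \<and> parcs D \<inter> map_arcs \<pi> (parcs D) = {})"
proof -
  have "\<exists>\<pi>. \<pi> permutes pverts D\<^sub>0 \<and> parcs D\<^sub>0 \<inter> map_arcs \<pi> (parcs D\<^sub>0) = {}"
    using assms(1) self_packing_K3_path[of P3] self_packing_K3_path[of V3]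
      self_packing_K3_path[of Lambda3] self_packing_K2_T4
    by (auto simp: P3_def V3_def Lambda3_def)
  then obtain \<pi> where \<pi>: "\<pi> permutes pverts D" "parcs D \<inter> map_arcs \<pi> (parcs D) = {}"
    using self_packing_transport[OF assms(2)] by blast
  \<comment> \<open>The copy \<open>D'\<close> is \<open>D\<close> itself. Its isomorphism with
    itself goes through \<open>D\<^sub>0\<close>, and well-formedness of \<open>D\<^sub>0\<close>
    allows the given isomorphism to be inverted.\<close>
  have "wf_digraph (with_proj D\<^sub>0)"
    using assms(2) by (auto simp: digraph_iso_def pre_digraph.digraph_isomorphism_def)
  then have "digraph_iso (with_proj D) (with_proj D)"
    using assms(2) digraph_iso_swap digraph_iso_trans by blast
  moreover have "packs D D"
    using \<pi> permutes_imp_bij unfolding packs_def by blast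
  ultimately show ?thesis using \<pi> by blast
qed

end
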